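(* Let $n\ge 1$, and let $Q'_n=\mathcal{PC}_n\setminus Q_n$. Then $|Q_n|=|Q'_n|$.
   Context: Let $X_n=\{1,2,\ldots,n\}$ with its natural order. A partial transformation of $X_n$ is a map $\alpha:\mathrm{Dom}\,\alpha\to X_n$ with $\mathrm{Dom}\,\alpha\subseteq X_n$ (the empty map is allowed); $x\alpha$ denotes the image of $x$. It is decreasing if $x\alpha\le x$ for all $x\in\mathrm{Dom}\,\alpha$, and order-preserving if $x\le y$ implies $x\alpha\le y\alpha$ for all $x,y\in\mathrm{Dom}\,\alpha$. $\mathcal{PC}_n$ is the set of all decreasing and order-preserving partial transformations of $X_n$, and $Q_n=\{\alpha\in\mathcal{PC}_n:1\in\mathrm{Dom}\,\alpha\}$. *)

theory Defs
  imports Main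
begin

definition chain :: "nat \<Rightarrow> nat set" where
  "chain n = {1..n}"

definition partial_transformations :: "nat \<Rightarrow> (nat \<rightharpoonup> nat) set" where
  "partial_transformations n = {\<alpha>. dom \<alpha> \<subseteq> chain n \<and> ran \<alpha> \<subseteq> chain n}"

definition decreasing :: "(nat \<rightharpoonup> nat) \<Rightarrow> bool" where
  "decreasing \<alpha> \<longleftrightarrow> (\<forall>x\<in>dom \<alpha>. the (\<alpha> x) \<le> x)"

definition order_preserving :: "(nat \<rightharpoonup> nat) \<Rightarrow> bool" where
  "order_preserving \<alpha> \<longleftrightarrow>
     (\<forall>x\<in>dom \<alpha>. \<forall>y\<in>dom \<alpha>. x \<le> y \<longrightarrow> the (\<alpha> x) \<le> the (\<alpha> y))"

definition PC :: "nat \<Rightarrow> (nat \<rightharpoonup> nat) set" where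
  "PC n = {\<alpha> \<in> partial_transformations n. decreasing \<alpha> \<and> order_preserving \<alpha>}"

definition Q :: "nat \<Rightarrow> (nat \<rightharpoonup> nat) set" where
  "Q n = {\<alpha> \<in> PC n. 1 \<in> dom \<alpha>}"

definition Q' :: "nat \<Rightarrow> (nat \<rightharpoonup> nat) set" where
  "Q' n = PC n - Q n"

(* Hence card on PC n and its subsets is the true cardinality. *)
lemma finite_PC: "finite (PC n)"
proof -
  have "PC n \<subseteq> (\<Union>D\<in>Pow (chain n). {\<alpha>. dom \<alpha> = D \<and> ran \<alpha> \<subseteq> chain n})"
    by (auto simp: PC_def partial_transformations_def)
  moreover have "finite (\<Union>D\<in>Pow (chain n). {\<alpha>. dom \<alpha> = D \<and> ran \<alpha> \<subseteq> chain n})"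
    by (rule finite_UN_I)
       (auto simp: chain_def intro!: finite_set_of_finite_maps dest: finite_subset[OF _ finite_atLeastAtMost])
  ultimately show ?thesis by (rule finite_subset)
qed

end

theory Submission
  imports Defs
begin

text \<open>The point 1 carries no information: a decreasing map defined at 1 must fix it, and adjoining
  the value 1 at 1 to a map undefined there never breaks order preservation, because 1 is
  the least point and also the least possible image. So forgetting the point 1 and
  adjoining the fixed point 1 are mutually inverse maps between \<^term>\<open>Q n\<close> and \<^term>\<open>Q' n\<close>.\<close>

lemma Q_fixes_1:
  assumes "\<alpha> \<in> Q n"
  shows "\<alpha> 1 = Some 1"
proof -
  obtain y where y: "\<alpha> 1 = Some y"
    using assms by (auto simp: Q_def)
  have "y \<in> ran \<alpha>"
    using y by (rule ranI)
  then have "1 \<le> y"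
    using assms by (auto simp: Q_def PC_def partial_transformations_def chain_def)
  moreover have "y \<le> 1"
    using assms y bspec[of "dom \<alpha>" "\<lambda>x. the (\<alpha> x) \<le> x" 1]
    by (simp add: Q_def PC_def decreasing_def)
  ultimately show ?thesis
    using y by simp
qed

lemma forget_1_in_Q':
  assumes "\<alpha> \<in> Q n"
  shows "\<alpha>(1 := None) \<in> Q' n"
proof -
  have "ran (\<alpha>(1 := None)) \<subseteq> ran \<alpha>"
    by (auto simp: ran_def)
  then show ?thesis
    using assms
    by (auto simp: Q_def Q'_def PC_def partial_transformations_def decreasing_def
        order_preserving_def)
qed

lemma adjoin_1_in_Q:
  assumes "n \<ge> 1" and "\<alpha> \<in> Q' n"
  shows "\<alpha>(1 \<mapsto> 1) \<in> Q n"
proof -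
  have PC: "\<alpha> \<in> PC n" and undef: "\<alpha> 1 = None"
    using assms(2) by (auto simp: Q'_def Q_def)
  have dom: "1 \<le> x" if "x \<in> dom \<alpha>" for x
    using PC that by (auto simp: PC_def partial_transformations_def chain_def)
  have ran: "1 \<le> the (\<alpha> x)" if "x \<in> dom \<alpha>" for x
    using PC that by (force simp: PC_def partial_transformations_def chain_def intro: ranI)
  have "\<alpha>(1 \<mapsto> 1) \<in> partial_transformations n"
    using PC undef assms(1) by (auto simp: PC_def partial_transformations_def chain_def)
  moreover have "decreasing (\<alpha>(1 \<mapsto> 1))"
    using PC by (auto simp: PC_def decreasing_def)
  moreover have "order_preserving (\<alpha>(1 \<mapsto> 1))"
    unfolding order_preserving_def
  proof (intro ballI impI)
    fix x y
    assume x: "x \<in> dom (\<alpha>(1 \<mapsto> 1))" and y: "y \<in> dom (\<alpha>(1 \<mapsto> 1))" and "x \<le> y"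
    show "the ((\<alpha>(1 \<mapsto> 1)) x) \<le> the ((\<alpha>(1 \<mapsto> 1)) y)"
    proof (cases "x = 1")
      case True
      then show ?thesis
        using y ran[of y] by auto
    next
      case False
      then have "x \<in> dom \<alpha>" and "y \<noteq> 1"
        using x dom[of x] \<open>x \<le> y\<close> by auto
      then show ?thesis
        using PC False y \<open>x \<le> y\<close> by (auto simp: PC_def order_preserving_def)
    qed
  qed
  ultimately show ?thesis
    by (simp add: Q_def PC_def)
qed

theorem lemma2p2:
  fixes n :: nat
  assumes "n \<ge> 1"
  shows "card (Q n) = card (Q' n)"
proof (rule bij_betw_same_card)
  show "bij_betw (\<lambda>\<alpha>. \<alpha>(1 := None)) (Q n) (Q' n)"
  proof (rule bij_betw_byWitness[where f' = "\<lambda>\<alpha>. \<alpha>(1 \<mapsto> 1)"])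
    show "\<forall>\<alpha>\<in>Q n. (\<alpha>(1 := None))(1 \<mapsto> 1) = \<alpha>"
      using Q_fixes_1 by (auto simp: fun_upd_idem)
    show "\<forall>\<alpha>\<in>Q' n. (\<alpha>(1 \<mapsto> 1))(1 := None) = \<alpha>"
      by (auto simp: Q'_def Q_def fun_upd_idem)
    show "(\<lambda>\<alpha>. \<alpha>(1 := None)) ` Q n \<subseteq> Q' n"
      using forget_1_in_Q' by blast
    show "(\<lambda>\<alpha>. \<alpha>(1 \<mapsto> 1)) ` Q' n \<subseteq> Q n"
      using adjoin_1_in_Q[OF assms] by blast
  qed
qed

end
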